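(* Let $R$ be a finite commutative ring with identity, written as a direct sum of local rings $R = R_1\oplus\cdots\oplus R_n$, where $R_i$ has unique maximal ideal $M_i$ and $q_i=|R_i/M_i|$. Assume $q_i>2$ for each $i$. For $k\ge 1$ let $\sum_{i=1}^k R^{**}=\{x_1+\cdots+x_k : x_1,\ldots,x_k\in R^{**}\}$. For $a\in R_i$ write $a+M_i=\{a+m: m\in M_i\}$, and $2=1+1$. (i) If $q_i>4$ for each $i$, then $R^{**}+R^{**}=R$. (ii) If $q_1=\cdots=q_s=3$ for some $s\ge1$ and $q_j>4$ for each $j>s$, then for any $k\ge 2$, $\sum_{i=1}^k R^{**}$ is the set of $(c_1,\ldots,c_n)\in R$ with $c_j$ arbitrary for $j>s$ and, for all $i\le s$: $c_i\in M_i$ if $k\equiv 0 \pmod 3$; $c_i\in 2+M_i$ if $k\equiv 1\pmod 3$; $c_i\in 1+M_i$ if $k\equiv 2\pmod 3$. In particular, every element of $R$ is a sum of exceptional units of $R$ if and only if $s=1$. (iii) If $q_1=\cdots=q_t=4$ for some $t\ge1$ and $q_j>4$ for each $j>t$, then for any $k\ge2$, $\sum_{i=1}^k R^{**}$ is the set of $(c_1,\ldots,c_n)\in R$ with $c_j$ arbitrary for $j>t$ and, for all $i\le t$: $c_i\in M_i\cup(1+M_i)$ if $k$ is even; $c_i\in R_i\setminus(M_i\cup(1+M_i))$ if $k$ is odd. In particular, every element of $R$ is a sum of exceptional units of $R$ if and only if $t=1$. (iv) If $q_1=\cdots=q_s=3$ ($s\ge1$), $q_{s+1}=\cdots=q_{s+t}=4$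 ($t\ge1$), and $q_j>4$ for each $j>s+t$, then for any $k\ge 2$, $\sum_{i=1}^k R^{**}$ is the set of $(c_1,\ldots,c_n)\in R$ with $c_j$ arbitrary for $j>s+t$ and such that: for $i\le s$, $c_i\in M_i$, $2+M_i$, $1+M_i$ according as $k\equiv 0,1,2\pmod 3$ respectively; and for $s<i\le s+t$, $c_i\in M_i\cup(1+M_i)$ if $k$ is even and $c_i\in R_i\setminus(M_i\cup(1+M_i))$ if $k$ is odd. (Equivalently, the six cases $k\equiv 0,1,2,3,4,5\pmod 6$ give for $i\le s$ the classes $M_i,2+M_i,1+M_i,M_i,2+M_i,1+M_i$ and for $s<i\le s+t$ alternately $M_i\cup(1+M_i)$ and $R_i\setminus(M_i\cup(1+M_i))$.) In particular, every element of $R$ is a sum of exceptional units of $R$ if and only if $s=t=1$.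
   Context: A unit $u$ of a commutative ring $R$ with identity is called exceptional if $1-u$ is also a unit; $R^{**}$ denotes the set of exceptional units. Every finite commutative ring with identity is uniquely a direct sum of finite local rings; elements are written as tuples $(c_1,\ldots,c_n)$, $c_i\in R_i$. *)

theory Defs
  imports "HOL-Algebra.Algebra"
begin

locale local_ring = cring R for R (structure) +
  assumes unique_maximalideal: "\<exists>!M. maximalideal M R"

(* Only meaningful for a local ring, where the description is unique. *)
definition max_ideal :: "('a, 'm) ring_scheme \<Rightarrow> 'a set"
  where "max_ideal R = (THE M. maximalideal M R)"

definition residue_order :: "('a, 'm) ring_scheme \<Rightarrow> nat"
  where "residue_order R = order (R Quot (max_ideal R))"

definition exc_units :: "('a, 'm) ring_scheme \<Rightarrow> 'a set"
  where "exc_units R = {u \<in> Units R. \<one>\<^bsub>R\<^esub> \<ominus>\<^bsub>R\<^esub> u \<in> Units R}"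

(* The terms of the sum may be repeated: x is any family indexed by 1,...,k. *)
definition exc_sums :: "('a, 'm) ring_scheme \<Rightarrow> nat \<Rightarrow> 'a set"
  where "exc_sums R k = {(\<Oplus>\<^bsub>R\<^esub>i\<in>{1..k}. x i) | x. \<forall>i\<in>{1..k}. x i \<in> exc_units R}"

definition all_sums_of_exc_units :: "('a, 'm) ring_scheme \<Rightarrow> bool"
  where "all_sums_of_exc_units R \<longleftrightarrow> (\<forall>a\<in>carrier R. \<exists>k\<ge>1. a \<in> exc_sums R k)"

definition one_coset :: "('a, 'm) ring_scheme \<Rightarrow> 'a set"
  where "one_coset R = \<one>\<^bsub>R\<^esub> <+\<^bsub>R\<^esub> max_ideal R"

definition two_coset :: "('a, 'm) ring_scheme \<Rightarrow> 'a set"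
  where "two_coset R = (\<one>\<^bsub>R\<^esub> \<oplus>\<^bsub>R\<^esub> \<one>\<^bsub>R\<^esub>) <+\<^bsub>R\<^esub> max_ideal R"

definition zero_one_cosets :: "('a, 'm) ring_scheme \<Rightarrow> 'a set"
  where "zero_one_cosets R = max_ideal R \<union> one_coset R"

(* The cosets of the maximal ideal that k-fold sums of exceptional units fill (k \<ge> 2) in a
   local ring with residue field of order 3 (class3), resp. of order 4 (class4). *)
definition class3 :: "('a, 'm) ring_scheme \<Rightarrow> nat \<Rightarrow> 'a set"
  where "class3 R k =
    (if k mod 3 = 0 then max_ideal R else if k mod 3 = 1 then two_coset R else one_coset R)"

definition class4 :: "('a, 'm) ring_scheme \<Rightarrow> nat \<Rightarrow> 'a set"
  where "class4 R k =
    (if even k then zero_one_cosets R else carrier R - zero_one_cosets R)"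

end

theory Submission
  imports Defs
begin

text \<open>Sums of exceptional units are computed componentwise in a product of rings. In a local
  component with residue field F, an element is exceptional iff its residue is neither 0 nor 1, so
  the k-fold sums are the preimage of the k-fold sums of F - {0,1}. That set is {2} when F has order
  3, it is the nontrivial coset of the subgroup {0,1} when F has order 4, and when F has more than
  four elements every c is u + v with u outside {0, 1, c, c - 1}. A sum of k terms therefore
  constrains only k mod 3 in a component of residue order 3 and only the parity of k in one of
  residue order 4. Two components of the same kind can make incompatible demands on k, whereas one
  of each kind cannot, by the Chinese remainder theorem.\<close>

section \<open>Sums of exceptional units\<close>

context cring
begin

lemma exc_units_closed: "u \<in> exc_units R \<Longrightarrow> u \<in> carrier R"
  by (auto simp: exc_units_def)

lemma exc_sums_0: "exc_sums R 0 = {\<zero>}"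
  by (auto simp: exc_sums_def)

text \<open>Splitting off the term with the largest index turns the description by indexed families
  into a recursion on \<open>k\<close>, on which the later inductions run.\<close>

lemma exc_sums_Suc: "exc_sums R (Suc k) = exc_sums R k <+>\<^bsub>R\<^esub> exc_units R"
proof -
  have finsum_Suc: "(\<Oplus>i\<in>{1..Suc k}. x i) = (\<Oplus>i\<in>{1..k}. x i) \<oplus> x (Suc k)"
    if "\<forall>i\<in>{1..Suc k}. x i \<in> exc_units R" for x
  proof -
    have "x \<in> {1..k} \<rightarrow> carrier R" "x (Suc k) \<in> carrier R"
      using that exc_units_closed by auto
    then show ?thesis
      by (simp add: atLeastAtMostSuc_conv finsum_insert a_comm)
  qed
  show ?thesis
  proof (intro equalityI subsetI)
    fix c assume "c \<in> exc_sums R (Suc k)"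
    then obtain x where "\<forall>i\<in>{1..Suc k}. x i \<in> exc_units R" "c = (\<Oplus>i\<in>{1..Suc k}. x i)"
      unfolding exc_sums_def by blast
    then show "c \<in> exc_sums R k <+>\<^bsub>R\<^esub> exc_units R"
      using finsum_Suc[of x] unfolding exc_sums_def set_add_def' by fastforce
  next
    fix c assume "c \<in> exc_sums R k <+>\<^bsub>R\<^esub> exc_units R"
    then obtain x u where x: "\<forall>i\<in>{1..k}. x i \<in> exc_units R" and u: "u \<in> exc_units R"
      and c: "c = (\<Oplus>i\<in>{1..k}. x i) \<oplus> u"
      unfolding exc_sums_def set_add_def' by blast
    \<comment> \<open>The override at \<open>Suc k\<close> leaves the first \<open>k\<close> terms,
      and hence their sum, unchanged.\<close>
    let ?y = "x(Suc k := u)"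
    have y: "\<forall>i\<in>{1..Suc k}. ?y i \<in> exc_units R"
      using x u by auto
    have "(\<Oplus>i\<in>{1..k}. ?y i) = (\<Oplus>i\<in>{1..k}. x i)"
      using x exc_units_closed by (intro finsum_cong') auto
    then have "c = (\<Oplus>i\<in>{1..Suc k}. ?y i)"
      using finsum_Suc[OF y] c by simp
    then show "c \<in> exc_sums R (Suc k)"
      using y unfolding exc_sums_def by blast
  qed
qed

lemma exc_sums_1: "exc_sums R (Suc 0) = exc_units R"
  using exc_units_closed by (force simp: exc_sums_Suc exc_sums_0 set_add_def')

lemma exc_sums_closed: "exc_sums R k \<subseteq> carrier R"
  by (induction k) (auto simp: exc_sums_0 exc_sums_Suc set_add_def' dest: exc_units_closed)

lemma exc_sums_2: "exc_sums R 2 = exc_units R <+>\<^bsub>R\<^esub> exc_units R"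
  using exc_sums_Suc[of "Suc 0"] by (simp add: exc_sums_1 numeral_2_eq_2)

end

text \<open>From right to left, the last summand \<open>v\<close> lifts to some \<open>u\<close> by
  surjectivity; then \<open>c \<ominus> u\<close> lies over the remaining sum and the induction
  hypothesis applies to it. The induction starts at 1 because the empty sum is only zero, whereas
  the preimage of zero is the whole kernel.\<close>

lemma exc_sums_surj_hom:
  fixes R (structure) and S (structure)
  assumes "ring_hom_cring R S h" and surj: "h ` carrier R = carrier S"
    and exc: "\<And>u. u \<in> carrier R \<Longrightarrow> u \<in> exc_units R \<longleftrightarrow> h u \<in> exc_units S"
    and "1 \<le> k" and "c \<in> carrier R"
  shows "c \<in> exc_sums R k \<longleftrightarrow> h c \<in> exc_sums S k"
proof -
  interpret ring_hom_cring R S h by fact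
  show ?thesis
    using \<open>1 \<le> k\<close> \<open>c \<in> carrier R\<close>
  proof (induction k arbitrary: c rule: dec_induct)
    case base
    then show ?case by (simp add: R.exc_sums_1 S.exc_sums_1 exc)
  next
    case (step k)
    show ?case
    proof
      assume "c \<in> exc_sums R (Suc k)"
      then obtain d u where "d \<in> exc_sums R k" "u \<in> exc_units R" "c = d \<oplus> u"
        by (auto simp: R.exc_sums_Suc set_add_def')
      moreover from this have "d \<in> carrier R" "u \<in> carrier R"
        using R.exc_sums_closed R.exc_units_closed by auto
      ultimately show "h c \<in> exc_sums S (Suc k)"
        using step.IH exc by (auto simp: S.exc_sums_Suc set_add_def')
    next
      assume "h c \<in> exc_sums S (Suc k)"
      then obtain d' v where d': "d' \<in> exc_sums S k" and v: "v \<in> exc_units S"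
        and hc: "h c = d' \<oplus>\<^bsub>S\<^esub> v"
        by (auto simp: S.exc_sums_Suc set_add_def')
      then obtain u where u: "u \<in> carrier R" "h u = v"
        using surj S.exc_units_closed by (metis imageE)
      have "d' \<in> carrier S" "v \<in> carrier S"
        using d' v S.exc_sums_closed S.exc_units_closed by auto
      then have "h (c \<ominus> u) = d'"
        using hc u step.prems by (simp add: a_minus_def S.a_assoc S.r_neg)
      then have "c \<ominus> u \<in> exc_sums R k" "u \<in> exc_units R"
        using step.IH[of "c \<ominus> u"] exc u v d' step.prems by auto
      moreover have "c = (c \<ominus> u) \<oplus> u"
        using u step.prems by (simp add: a_minus_def R.a_assoc R.l_neg)
      ultimately show "c \<in> exc_sums R (Suc k)"
        by (auto simp: R.exc_sums_Suc set_add_def')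
    qed
  qed
qed

section \<open>Finite fields\<close>

context field
begin

lemma exc_units_field: "exc_units R = carrier R - {\<zero>, \<one>}"
proof -
  have "\<one> \<ominus> u = \<zero> \<longleftrightarrow> u = \<one>" if "u \<in> carrier R" for u
    using that by (metis r_right_minus_eq one_closed)
  then show ?thesis
    by (auto simp: exc_units_def field_Units)
qed

lemma exc_sums_order_gt_4:
  assumes "order R > 4" and "2 \<le> k"
  shows "exc_sums R k = carrier R"
  using \<open>2 \<le> k\<close>
proof (induction k rule: dec_induct)
  case base
  have "c \<in> exc_sums R 2" if c: "c \<in> carrier R" for c
  proof -
    \<comment> \<open>The values \<open>\<zero>\<close> and \<open>\<one>\<close> of
      \<open>u\<close> are not exceptional; the values \<open>c\<close> and
      \<open>c \<ominus> \<one>\<close> would make the other summand \<open>c \<ominus> u\<close>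
      equal to \<open>\<zero>\<close> or \<open>\<one>\<close>.\<close>
    have "card {\<zero>, \<one>, c, c \<ominus> \<one>} \<le> 4"
      using card_insert_le_m1 by (simp add: card_insert_if)
    also have "\<dots> < card (carrier R)"
      using assms by (simp add: order_def)
    finally have "\<not> carrier R \<subseteq> {\<zero>, \<one>, c, c \<ominus> \<one>}"
      by (metis card_mono finite.emptyI finite.insertI leD)
    then obtain u where u: "u \<in> carrier R" "u \<notin> {\<zero>, \<one>, c, c \<ominus> \<one>}"
      by blast
    have "c = u \<oplus> (c \<ominus> u)"
      using u c by (simp add: a_minus_def a_lcomm r_neg)
    moreover have "c \<ominus> u \<noteq> \<zero>" "c \<ominus> u \<noteq> \<one>"
    proof -
      show "c \<ominus> u \<noteq> \<zero>" using u c by auto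
      show "c \<ominus> u \<noteq> \<one>"
      proof
        assume "c \<ominus> u = \<one>"
        moreover have "u = c \<ominus> (c \<ominus> u)"
          using u c by algebra
        ultimately show False using u by simp
      qed
    qed
    ultimately show ?thesis
      unfolding exc_sums_2 exc_units_field set_add_def' using u c by blast
  qed
  then show ?case using exc_sums_closed by blast
next
  case (step k)
  \<comment> \<open>One exceptional \<open>u\<close> is enough from here on: translation by
    \<open>u\<close> maps the whole field onto itself.\<close>
  have "\<not> carrier R \<subseteq> {\<zero>, \<one>}"
    using card_mono[of "{\<zero>, \<one>}" "carrier R"] assms by (auto simp: order_def)
  then obtain u where u: "u \<in> carrier R" "u \<in> exc_units R"
    unfolding exc_units_field by blast
  have "c \<in> exc_sums R (Suc k)" if c: "c \<in> carrier R" for c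
  proof -
    have "c = (c \<ominus> u) \<oplus> u"
      using u c by (simp add: a_minus_def a_assoc l_neg)
    moreover have "c \<ominus> u \<in> exc_sums R k" using c u step.IH by simp
    ultimately show ?thesis using u by (auto simp: exc_sums_Suc set_add_def')
  qed
  then show ?case using exc_sums_closed by blast
qed

text \<open>The additive group has order 3, so \<open>\<one> \<oplus> \<one> \<oplus> \<one>\<close>
  vanishes. Then \<open>\<one> \<oplus> \<one>\<close> differs from \<open>\<zero>\<close> and
  \<open>\<one>\<close>, and counting gives the carrier.\<close>

lemma order_3_facts:
  assumes "order R = 3"
  shows "\<one> \<oplus> \<one> \<notin> {\<zero>, \<one>}" "\<one> \<oplus> \<one> \<oplus> \<one> = \<zero>" "carrier R = {\<zero>, \<one>, \<one> \<oplus> \<one>}"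
proof -
  have fin: "finite (carrier R)"
    using assms by (metis card.infinite order_def zero_neq_numeral)
  have "[order R] \<cdot> \<one> = \<zero>"
    using add.pow_order_eq_1[of \<one>] by (simp add: order_def)
  then show three: "\<one> \<oplus> \<one> \<oplus> \<one> = \<zero>"
    by (simp add: assms numeral_3_eq_3 add_pow_def)
  show two: "\<one> \<oplus> \<one> \<notin> {\<zero>, \<one>}"
    using three by auto
  have "card {\<zero>, \<one>, \<one> \<oplus> \<one>} = card (carrier R)"
    using two assms by (auto simp: order_def card_insert_if)
  then show "carrier R = {\<zero>, \<one>, \<one> \<oplus> \<one>}"
    using card_subset_eq[OF fin, of "{\<zero>, \<one>, \<one> \<oplus> \<one>}"] by auto
qed

text \<open>The only exceptional unit is 2, so a sum of \<open>k\<close> of them is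
  \<open>2k\<close>, which runs through 2, 1, 0 with period 3.\<close>

lemma exc_sums_order_3:
  assumes "order R = 3" and "1 \<le> k"
  shows "exc_sums R k =
    {if k mod 3 = 0 then \<zero> else if k mod 3 = 1 then \<one> \<oplus> \<one> else \<one>}"
proof -
  note F = order_3_facts[OF assms(1)]
  have exc: "exc_units R = {\<one> \<oplus> \<one>}"
    unfolding exc_units_field using F(1) by (subst F(3)) auto
  show ?thesis
    using \<open>1 \<le> k\<close>
  proof (induction k rule: dec_induct)
    case base
    then show ?case by (simp add: exc_sums_1 exc)
  next
    case (step k)
    have "\<one> \<oplus> \<one> \<oplus> (\<one> \<oplus> \<one>) = \<one>"
      using F(2) by (simp flip: a_assoc)
    moreover have "\<one> \<oplus> (\<one> \<oplus> \<one>) = \<zero>"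
      using F(2) by (simp flip: a_assoc)
    ultimately show ?case
      using step.IH by (auto simp: exc_sums_Suc exc set_add_def' mod_Suc)
  qed
qed

text \<open>The field has characteristic 2, and its additive group is the Klein four-group generated
  by \<open>\<one>\<close> and any \<open>z\<close> outside
  \<open>{\<zero>, \<one>}\<close>.\<close>

lemma order_4_facts:
  assumes "order R = 4"
  obtains z where "z \<in> carrier R" "z \<oplus> z = \<zero>" "\<one> \<oplus> \<one> = \<zero>"
    "carrier R = {\<zero>, \<one>, z, \<one> \<oplus> z}" "z \<notin> {\<zero>, \<one>}" "\<one> \<oplus> z \<notin> {\<zero>, \<one>}"
proof -
  have fin: "finite (carrier R)"
    using assms by (metis card.infinite order_def zero_neq_numeral)
  have "[order R] \<cdot> \<one> = \<zero>"
    using add.pow_order_eq_1[of \<one>] by (simp add: order_def)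
  then have "\<one> \<oplus> \<one> \<oplus> \<one> \<oplus> \<one> = \<zero>"
    by (simp add: assms numeral_eq_Suc add_pow_def)
  \<comment> \<open>The sum of four ones is the square of \<open>\<one> \<oplus> \<one>\<close>, and
    a field has no zero divisors.\<close>
  then have "(\<one> \<oplus> \<one>) \<otimes> (\<one> \<oplus> \<one>) = \<zero>"
    by (simp add: l_distr r_distr flip: a_assoc)
  then have two: "\<one> \<oplus> \<one> = \<zero>"
    using integral_iff by (metis add.m_closed one_closed)
  have "\<not> carrier R \<subseteq> {\<zero>, \<one>}"
    using card_mono[of "{\<zero>, \<one>}" "carrier R"] assms by (auto simp: order_def)
  then obtain z where z: "z \<in> carrier R" "z \<notin> {\<zero>, \<one>}" by blast
  have zz: "z \<oplus> z = \<zero>"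
    using two z by (metis l_distr l_null l_one one_closed)
  have "\<one> \<oplus> z \<noteq> \<zero>" using two z by (metis insertCI one_closed add.l_cancel)
  moreover have "\<one> \<oplus> z \<noteq> \<one>" using z by simp
  moreover have "\<one> \<oplus> z \<noteq> z" using z by simp
  moreover have "card {\<zero>, \<one>, z, \<one> \<oplus> z} = card (carrier R)"
    using z calculation assms by (auto simp: order_def card_insert_if)
  then have "carrier R = {\<zero>, \<one>, z, \<one> \<oplus> z}"
    using card_subset_eq[OF fin, of "{\<zero>, \<one>, z, \<one> \<oplus> z}"] z by auto
  ultimately show thesis using that z zz two by blast
qed

lemma exc_sums_order_4:
  assumes "order R = 4" and "1 \<le> k"
  shows "exc_sums R k = (if even k then {\<zero>, \<one>} else carrier R - {\<zero>, \<one>})"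
proof -
  obtain z where z: "z \<in> carrier R" "z \<oplus> z = \<zero>" "\<one> \<oplus> \<one> = \<zero>"
    "carrier R = {\<zero>, \<one>, z, \<one> \<oplus> z}" "z \<notin> {\<zero>, \<one>}" "\<one> \<oplus> z \<notin> {\<zero>, \<one>}"
    using order_4_facts[OF assms(1)] .
  have compl: "carrier R - {\<zero>, \<one>} = {z, \<one> \<oplus> z}"
    by (subst z(4)) (use z(5,6) in auto)
  \<comment> \<open>These entries of the addition table express addition modulo the subgroup
    \<open>{\<zero>, \<one>}\<close>: adding the coset \<open>{z, \<one> \<oplus> z}\<close> swaps
    the two cosets.\<close>
  have eqs: "\<one> \<oplus> (\<one> \<oplus> z) = z" "z \<oplus> (\<one> \<oplus> z) = \<one>" "\<one> \<oplus> z \<oplus> z = \<one>"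
      "\<one> \<oplus> z \<oplus> (\<one> \<oplus> z) = \<zero>"
  proof -
    show a: "\<one> \<oplus> (\<one> \<oplus> z) = z" using z(1,3) by (simp flip: a_assoc)
    show "z \<oplus> (\<one> \<oplus> z) = \<one>" using z(1,2) by (simp add: a_lcomm[of z])
    show "\<one> \<oplus> z \<oplus> z = \<one>" using z(1,2) by (simp add: a_assoc)
    show "\<one> \<oplus> z \<oplus> (\<one> \<oplus> z) = \<zero>" using z(1-3) by (simp add: a_assoc a_lcomm[of z])
  qed
  show ?thesis
    using \<open>1 \<le> k\<close>
  proof (induction k rule: dec_induct)
    case base
    then show ?case by (simp add: exc_sums_1 exc_units_field)
  next
    case (step k)
    show ?case
    proof (cases "even k")
      case True
      have "exc_sums R (Suc k) = {\<zero>, \<one>} <+>\<^bsub>R\<^esub> {z, \<one> \<oplus> z}"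
        using True step.IH by (simp add: exc_sums_Suc exc_units_field compl)
      also have "\<dots> = {z, \<one> \<oplus> z}"
        using z(1) eqs by (auto simp: set_add_def')
      finally show ?thesis using True compl by simp
    next
      case False
      have "exc_sums R (Suc k) = {z, \<one> \<oplus> z} <+>\<^bsub>R\<^esub> {z, \<one> \<oplus> z}"
        using False step.IH by (simp add: exc_sums_Suc exc_units_field compl)
      also have "\<dots> = {\<zero>, \<one>}"
        using z(2) eqs by (auto simp: set_add_def')
      finally show ?thesis using False by simp
    qed
  qed
qed

end

section \<open>Finite local rings\<close>

context local_ring
begin

lemma maximalideal_max_ideal: "maximalideal (max_ideal R) R"
  unfolding max_ideal_def using unique_maximalideal by (rule theI')

lemma maximalideal_eq_max_ideal: "maximalideal M R \<Longrightarrow> M = max_ideal R"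
  using unique_maximalideal maximalideal_max_ideal by blast

sublocale max_ideal: maximalideal "max_ideal R" R
  by (rule maximalideal_max_ideal)

lemma field_residue: "field (R Quot max_ideal R)"
  using max_ideal.quotient_is_field is_cring by blast

lemma residue_hom: "ring_hom_cring R (R Quot max_ideal R) ((+>) (max_ideal R))"
  using max_ideal.rcos_ring_hom_cring is_cring by blast

lemma residue_surj: "(+>) (max_ideal R) ` carrier R = carrier (R Quot max_ideal R)"
  by (auto simp: FactRing_def A_RCOSETS_def')

text \<open>The quotient ring is built from cosets \<open>I +> x\<close>, while
  \<open>one_coset\<close> and \<open>two_coset\<close> are written with \<open><+\<close>;
  commutativity of addition identifies the two.\<close>

lemma residue_eq_iff:
  assumes "x \<in> carrier R" "y \<in> carrier R"
  shows "max_ideal R +> x = max_ideal R +> y \<longleftrightarrow> x \<in> y <+ max_ideal R"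
proof -
  have "y <+ max_ideal R = max_ideal R +> y"
    using max_ideal.a_coset_eq assms by auto
  then show ?thesis
    using assms max_ideal.a_rcos_self[of x] max_ideal.a_repr_independence'[of x y] by metis
qed

lemma residue_eq_zero_iff:
  assumes "x \<in> carrier R"
  shows "max_ideal R +> x = max_ideal R \<longleftrightarrow> x \<in> max_ideal R"
  using assms max_ideal.a_rcos_const max_ideal.a_rcos_self by auto

text \<open>Finiteness replaces Zorn's lemma here.\<close>

lemma nonunit_in_max_ideal:
  assumes "finite (carrier R)" and x: "x \<in> carrier R" "x \<notin> Units R"
  shows "x \<in> max_ideal R"
proof -
  \<comment> \<open>The proper ideals containing \<open>x\<close>: there are finitely many, and
    \<open>PIdl x\<close> is one of them because \<open>x\<close> is not a unit.\<close>
  define P where "P = {I. ideal I R \<and> x \<in> I \<and> \<one> \<notin> I}"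
  have "P \<subseteq> Pow (carrier R)"
    unfolding P_def using ideal.Icarr by fastforce
  then have "finite P"
    using assms(1) by (simp add: finite_subset)
  moreover have "PIdl x \<in> P"
  proof -
    have "\<one> \<notin> PIdl x"
      using x by (auto simp: cgenideal_def Units_def) (metis m_comm)
    then show ?thesis
      unfolding P_def using x cgenideal_ideal cgenideal_self by simp
  qed
  ultimately obtain M where M: "M \<in> P" and max: "\<And>J. J \<in> P \<Longrightarrow> M \<subseteq> J \<Longrightarrow> M = J"
    using finite_has_maximal[of P] by auto
  \<comment> \<open>An ideal \<open>J\<close> above \<open>M\<close> contains \<open>x\<close>, so
    it either lies in \<open>P\<close>, and then equals \<open>M\<close>, or contains
    \<open>\<one>\<close>.\<close>
  have "maximalideal M R"
  proof (rule maximalidealI)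
    show "ideal M R" "carrier R \<noteq> M"
      using M unfolding P_def by auto
    fix J assume J: "ideal J R" "M \<subseteq> J" "J \<subseteq> carrier R"
    show "J = M \<or> J = carrier R"
    proof (cases "\<one> \<in> J")
      case True
      then show ?thesis using J ideal.one_imp_carrier by blast
    next
      case False
      then have "J \<in> P" using J M unfolding P_def by auto
      then show ?thesis using max J by blast
    qed
  qed
  then show ?thesis
    using M maximalideal_eq_max_ideal unfolding P_def by blast
qed

text \<open>Both sides say that \<open>x\<close> is outside the maximal ideal: in \<open>R\<close>
  because all nonunits lie in that ideal, in the quotient because it is a field whose zero is that
  ideal.\<close>

lemma Units_iff_residue:
  assumes "finite (carrier R)" and x: "x \<in> carrier R"
  shows "x \<in> Units R \<longleftrightarrow> max_ideal R +> x \<in> Units (R Quot max_ideal R)"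
proof -
  interpret F: field "R Quot max_ideal R" by (rule field_residue)
  have "x \<in> Units R \<longleftrightarrow> x \<notin> max_ideal R"
  proof
    assume u: "x \<in> Units R"
    show "x \<notin> max_ideal R"
    proof
      assume "x \<in> max_ideal R"
      then have "inv x \<otimes> x \<in> max_ideal R"
        using u max_ideal.I_l_closed by blast
      then show False
        using u max_ideal.one_imp_carrier max_ideal.I_notcarr by simp
    qed
  qed (use nonunit_in_max_ideal assms in blast)
  also have "\<dots> \<longleftrightarrow> max_ideal R +> x \<noteq> \<zero>\<^bsub>R Quot max_ideal R\<^esub>"
    using residue_eq_zero_iff[OF x] by (simp add: FactRing_def)
  also have "\<dots> \<longleftrightarrow> max_ideal R +> x \<in> Units (R Quot max_ideal R)"
    using residue_surj x by (auto simp: F.field_Units)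
  finally show ?thesis .
qed

text \<open>The unit criterion, applied to \<open>u\<close> and to
  \<open>\<one> \<ominus> u\<close>, shows that being exceptional depends only on the residue; the
  transfer along surjections then covers sums.\<close>

lemma exc_sums_iff_residue:
  assumes fin: "finite (carrier R)" and "1 \<le> k" and "c \<in> carrier R"
  shows "c \<in> exc_sums R k \<longleftrightarrow> max_ideal R +> c \<in> exc_sums (R Quot max_ideal R) k"
proof (rule exc_sums_surj_hom[OF residue_hom residue_surj _ assms(2,3)])
  fix u assume u: "u \<in> carrier R"
  interpret H: ring_hom_cring R "R Quot max_ideal R" "(+>) (max_ideal R)"
    by (rule residue_hom)
  have "max_ideal R +> (\<one> \<ominus> u) =
    \<one>\<^bsub>R Quot max_ideal R\<^esub> \<ominus>\<^bsub>R Quot max_ideal R\<^esub> (max_ideal R +> u)"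
    using u by (simp add: a_minus_def)
  then show "u \<in> exc_units R \<longleftrightarrow> max_ideal R +> u \<in> exc_units (R Quot max_ideal R)"
    using u Units_iff_residue[OF fin, of u] Units_iff_residue[OF fin, of "\<one> \<ominus> u"]
    by (simp add: exc_units_def)
qed

lemma exc_sums_residue_order_gt_4:
  assumes "finite (carrier R)" and "residue_order R > 4" and "2 \<le> k"
  shows "exc_sums R k = carrier R"
proof -
  interpret F: field "R Quot max_ideal R" by (rule field_residue)
  have F: "exc_sums (R Quot max_ideal R) k = carrier (R Quot max_ideal R)"
    using F.exc_sums_order_gt_4 assms by (simp add: residue_order_def)
  have "c \<in> exc_sums R k" if "c \<in> carrier R" for c
  proof -
    have "max_ideal R +> c \<in> carrier (R Quot max_ideal R)"
      using that residue_surj by blast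
    then show ?thesis
      using that assms F exc_sums_iff_residue[of k c] by simp
  qed
  then show ?thesis
    using exc_sums_closed by blast
qed

section \<open>Cosets of the maximal ideal as fibres of the residue map\<close>

lemma residue_zero: "\<zero>\<^bsub>R Quot max_ideal R\<^esub> = max_ideal R"
  and residue_one: "\<one>\<^bsub>R Quot max_ideal R\<^esub> = max_ideal R +> \<one>"
  by (simp_all add: FactRing_def)

lemma residue_two:
  "\<one>\<^bsub>R Quot max_ideal R\<^esub> \<oplus>\<^bsub>R Quot max_ideal R\<^esub> \<one>\<^bsub>R Quot max_ideal R\<^esub> = max_ideal R +> (\<one> \<oplus> \<one>)"
proof -
  interpret H: ring_hom_cring R "R Quot max_ideal R" "(+>) (max_ideal R)"
    by (rule residue_hom)
  show ?thesis by simp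
qed

lemma max_ideal_iff_residue:
  "x \<in> carrier R \<Longrightarrow> x \<in> max_ideal R \<longleftrightarrow> max_ideal R +> x = \<zero>\<^bsub>R Quot max_ideal R\<^esub>"
  using residue_eq_zero_iff by (simp add: residue_zero)

lemma one_coset_iff_residue:
  "x \<in> carrier R \<Longrightarrow> x \<in> one_coset R \<longleftrightarrow> max_ideal R +> x = \<one>\<^bsub>R Quot max_ideal R\<^esub>"
  using residue_eq_iff by (simp add: residue_one one_coset_def)

lemma two_coset_iff_residue:
  "x \<in> carrier R \<Longrightarrow> x \<in> two_coset R \<longleftrightarrow> max_ideal R +> x =
    \<one>\<^bsub>R Quot max_ideal R\<^esub> \<oplus>\<^bsub>R Quot max_ideal R\<^esub> \<one>\<^bsub>R Quot max_ideal R\<^esub>"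
  using residue_eq_iff by (simp add: residue_two two_coset_def)

lemmas coset_iff_residue =
  max_ideal_iff_residue one_coset_iff_residue two_coset_iff_residue

lemma class3_iff_exc_sums:
  assumes "finite (carrier R)" and "residue_order R = 3" and "1 \<le> k" and "c \<in> carrier R"
  shows "c \<in> class3 R k \<longleftrightarrow> c \<in> exc_sums R k"
proof -
  interpret F: field "R Quot max_ideal R" by (rule field_residue)
  show ?thesis
    using F.exc_sums_order_3[of k] exc_sums_iff_residue[of k c] assms
    by (simp add: residue_order_def class3_def coset_iff_residue)
qed

lemma class4_iff_exc_sums:
  assumes "finite (carrier R)" and "residue_order R = 4" and "1 \<le> k" and "c \<in> carrier R"
  shows "c \<in> class4 R k \<longleftrightarrow> c \<in> exc_sums R k"
proof -
  interpret F: field "R Quot max_ideal R" by (rule field_residue)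
  have "max_ideal R +> c \<in> carrier (R Quot max_ideal R)"
    using assms(4) residue_surj by blast
  then show ?thesis
    using F.exc_sums_order_4[of k] exc_sums_iff_residue[of k c] assms
    by (simp add: residue_order_def class4_def zero_one_cosets_def coset_iff_residue)
qed

section \<open>Which numbers of terms a given element admits\<close>

text \<open>The three cosets cover a ring of residue order 3, and \<open>class3\<close> depends on
  \<open>k\<close> only modulo 3. The witnesses 0, 1, 2 belong to the residues 0, 2, 1.\<close>

lemma class3_exists:
  assumes "residue_order R = 3" and "c \<in> carrier R"
  shows "\<exists>r<3. \<forall>k. k mod 3 = r \<longrightarrow> c \<in> class3 R k"
proof -
  interpret F: field "R Quot max_ideal R" by (rule field_residue)
  have "max_ideal R +> c \<in> carrier (R Quot max_ideal R)"
    using assms(2) residue_surj by blast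
  moreover have "order (R Quot max_ideal R) = 3"
    using assms(1) by (simp add: residue_order_def)
  ultimately have "max_ideal R +> c \<in> {\<zero>\<^bsub>R Quot max_ideal R\<^esub>, \<one>\<^bsub>R Quot max_ideal R\<^esub>,
      \<one>\<^bsub>R Quot max_ideal R\<^esub> \<oplus>\<^bsub>R Quot max_ideal R\<^esub> \<one>\<^bsub>R Quot max_ideal R\<^esub>}"
    using F.order_3_facts(3) by blast
  then consider "c \<in> max_ideal R" | "c \<in> two_coset R" | "c \<in> one_coset R"
    using coset_iff_residue[OF assms(2)] by blast
  then show ?thesis
  proof cases
    case 1
    then show ?thesis by (intro exI[of _ 0]) (simp add: class3_def)
  next
    case 2
    then show ?thesis by (intro exI[of _ 1]) (simp add: class3_def)
  next
    case 3
    then show ?thesis by (intro exI[of _ 2]) (simp add: class3_def)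
  qed
qed

text \<open>The sets for even and for odd \<open>k\<close> are complementary.\<close>

lemma class4_exists:
  assumes "c \<in> carrier R"
  shows "\<exists>b. \<forall>k. even k = b \<longrightarrow> c \<in> class4 R k"
  using assms by (cases "c \<in> zero_one_cosets R") (auto simp: class4_def)

text \<open>The residues 0, 1 and 2 are distinct, so zero lies in only one of the three cosets.
  Together with the analogous fact for one, this supplies incompatible demands on \<open>k\<close>
  in two components.\<close>

lemma zero_in_class3_iff:
  assumes "residue_order R = 3"
  shows "\<zero> \<in> class3 R k \<longleftrightarrow> k mod 3 = 0"
proof -
  interpret F: field "R Quot max_ideal R" by (rule field_residue)
  interpret H: ring_hom_cring R "R Quot max_ideal R" "(+>) (max_ideal R)"
    by (rule residue_hom)
  have "\<one>\<^bsub>R Quot max_ideal R\<^esub> \<oplus>\<^bsub>R Quot max_ideal R\<^esub> \<one>\<^bsub>R Quot max_ideal R\<^esub>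
      \<noteq> \<zero>\<^bsub>R Quot max_ideal R\<^esub>"
    using F.order_3_facts(1) assms by (simp add: residue_order_def)
  then show ?thesis
    using H.hom_zero F.one_not_zero coset_iff_residue[OF zero_closed]
    by (auto simp: class3_def)
qed

lemma one_in_class3_iff:
  assumes "residue_order R = 3"
  shows "\<one> \<in> class3 R k \<longleftrightarrow> k mod 3 = 2"
proof -
  interpret F: field "R Quot max_ideal R" by (rule field_residue)
  interpret H: ring_hom_cring R "R Quot max_ideal R" "(+>) (max_ideal R)"
    by (rule residue_hom)
  have "\<one>\<^bsub>R Quot max_ideal R\<^esub> \<oplus>\<^bsub>R Quot max_ideal R\<^esub> \<one>\<^bsub>R Quot max_ideal R\<^esub>
      \<noteq> \<one>\<^bsub>R Quot max_ideal R\<^esub>"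
    using F.order_3_facts(1) assms by (simp add: residue_order_def)
  moreover have "k mod 3 \<in> {0, 1, 2}" by auto
  ultimately show ?thesis
    using H.hom_one F.one_not_zero coset_iff_residue[OF one_closed]
    by (auto simp: class3_def)
qed

lemma zero_in_class4_iff: "\<zero> \<in> class4 R k \<longleftrightarrow> even k"
  by (simp add: class4_def zero_one_cosets_def)

text \<open>Any lift of a residue other than 0 and 1 works. It is the counterpart of zero, which
  demands an even \<open>k\<close>.\<close>

lemma ex_in_class4_iff_odd:
  assumes "residue_order R = 4"
  obtains z where "z \<in> carrier R" "\<And>k. z \<in> class4 R k \<longleftrightarrow> odd k"
proof -
  interpret F: field "R Quot max_ideal R" by (rule field_residue)
  obtain y where "y \<in> carrier (R Quot max_ideal R)"
    "y \<notin> {\<zero>\<^bsub>R Quot max_ideal R\<^esub>, \<one>\<^bsub>R Quot max_ideal R\<^esub>}"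
    using F.order_4_facts assms unfolding residue_order_def by metis
  moreover from this obtain z where z: "z \<in> carrier R" "max_ideal R +> z = y"
    using residue_surj by (metis imageE)
  ultimately have "z \<notin> zero_one_cosets R"
    by (simp add: zero_one_cosets_def coset_iff_residue)
  with z(1) show thesis
    using that by (simp add: class4_def)
qed

end

section \<open>Products of local rings\<close>

text \<open>Consing is a ring homomorphism from the binary product of the head ring and the tail
  product, where the operations are componentwise.\<close>

lemma RDirProd_list_Cons_ops:
  assumes "a \<in> carrier R" "b \<in> carrier R"
    and "as \<in> carrier (RDirProd_list Rs)" "bs \<in> carrier (RDirProd_list Rs)"
  shows "(a # as) \<oplus>\<^bsub>RDirProd_list (R # Rs)\<^esub> (b # bs) =
      (a \<oplus>\<^bsub>R\<^esub> b) # (as \<oplus>\<^bsub>RDirProd_list Rs\<^esub> bs)"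
    and "(a # as) \<otimes>\<^bsub>RDirProd_list (R # Rs)\<^esub> (b # bs) =
      (a \<otimes>\<^bsub>R\<^esub> b) # (as \<otimes>\<^bsub>RDirProd_list Rs\<^esub> bs)"
proof -
  have "(a, as) \<in> carrier (RDirProd R (RDirProd_list Rs))"
    "(b, bs) \<in> carrier (RDirProd R (RDirProd_list Rs))"
    using assms by (simp_all add: RDirProd_carrier)
  then show "(a # as) \<oplus>\<^bsub>RDirProd_list (R # Rs)\<^esub> (b # bs) =
      (a \<oplus>\<^bsub>R\<^esub> b) # (as \<oplus>\<^bsub>RDirProd_list Rs\<^esub> bs)"
    "(a # as) \<otimes>\<^bsub>RDirProd_list (R # Rs)\<^esub> (b # bs) =
      (a \<otimes>\<^bsub>R\<^esub> b) # (as \<otimes>\<^bsub>RDirProd_list Rs\<^esub> bs)"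
    using ring_hom_add[OF RDirProd_list_hom1] ring_hom_mult[OF RDirProd_list_hom1]
    by (fastforce simp: RDirProd_def DirProd_def monoid.defs)+
qed

lemma RDirProd_list_nth:
  assumes "as \<in> carrier (RDirProd_list Rs)" "bs \<in> carrier (RDirProd_list Rs)" "i < length Rs"
  shows "(as \<oplus>\<^bsub>RDirProd_list Rs\<^esub> bs) ! i = as ! i \<oplus>\<^bsub>Rs ! i\<^esub> bs ! i"
    and "(as \<otimes>\<^bsub>RDirProd_list Rs\<^esub> bs) ! i = as ! i \<otimes>\<^bsub>Rs ! i\<^esub> bs ! i"
  using assms
proof (induction Rs arbitrary: as bs i)
  case (Cons R Rs)
  { case 1
    then show ?case
      using Cons.IH(1)
      by (cases i) (auto simp: RDirProd_list_carrier RDirProd_list_Cons_ops)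
  }
  { case 2
    then show ?case
      using Cons.IH(2)
      by (cases i) (auto simp: RDirProd_list_carrier RDirProd_list_Cons_ops)
  }
qed simp_all

lemma RDirProd_list_one_nth:
  "i < length Rs \<Longrightarrow> \<one>\<^bsub>RDirProd_list Rs\<^esub> ! i = \<one>\<^bsub>Rs ! i\<^esub>"
  unfolding RDirProd_list_one
  by (induction Rs arbitrary: i) (auto simp: nth_Cons split: nat.split)

section \<open>Componentwise description of exceptional units and their sums\<close>

text \<open>The direct sum enters as an isomorphism \<phi> onto a product of a list of rings, so the
  tuple entry of \<open>c\<close> at \<open>i\<close> is \<open>\<phi> c ! i\<close>, counted from
  0.\<close>

locale finite_ring_decomp = cring R
  for R :: "('r, 'm) ring_scheme" (structure)
    and Rs :: "('a, 'n) ring_scheme list"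
    and \<phi> :: "'r \<Rightarrow> 'a list" +
  assumes finite_carrier: "finite (carrier R)"
    and local_components: "i < length Rs \<Longrightarrow> local_ring (Rs ! i)"
    and iso: "\<phi> \<in> ring_iso R (RDirProd_list Rs)"
begin

lemma proj_hom:
  assumes "i < length Rs"
  shows "ring_hom_cring R (Rs ! i) (\<lambda>c. \<phi> c ! i)"
proof -
  interpret S: local_ring "Rs ! i" using local_components assms .
  have "(\<lambda>c. \<phi> c ! i) \<in> ring_hom R (Rs ! i)"
    using assms RDirProd_list_nth[where Rs = Rs and i = i]
      RDirProd_list_carrier_mem(2)[where Rs = Rs and i = i]
    by (intro ring_hom_memI) (simp_all add: ring_iso_memE[OF iso] RDirProd_list_one_nth)
  then show ?thesis
    by (simp add: ring_hom_cring_def ring_hom_cring_axioms_def is_cring S.is_cring)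
qed

lemma proj_eqI:
  assumes "x \<in> carrier R" "y \<in> carrier R"
    and "\<And>i. i < length Rs \<Longrightarrow> \<phi> x ! i = \<phi> y ! i"
  shows "x = y"
proof -
  have "\<phi> x \<in> carrier (RDirProd_list Rs)" "\<phi> y \<in> carrier (RDirProd_list Rs)"
    using assms ring_iso_memE(1)[OF iso] by auto
  then have "\<phi> x = \<phi> y"
    using assms(3) RDirProd_list_carrier_mem(1) by (metis nth_equalityI)
  then show ?thesis
    using ring_iso_memE(5)[OF iso] assms by (auto simp: bij_betw_def inj_on_def)
qed

lemma proj_surj:
  assumes "\<And>i. i < length Rs \<Longrightarrow> c i \<in> carrier (Rs ! i)"
  obtains x where "x \<in> carrier R" "\<And>i. i < length Rs \<Longrightarrow> \<phi> x ! i = c i"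
proof -
  let ?l = "map c [0..<length Rs]"
  have "?l \<in> carrier (RDirProd_list Rs)"
    using assms by (intro RDirProd_list_carrier_memI) auto
  then obtain x where "x \<in> carrier R" "\<phi> x = ?l"
    using ring_iso_memE(5)[OF iso] unfolding bij_betw_def by (metis imageE)
  then show thesis using that by simp
qed

lemma proj_closed:
  assumes "i < length Rs" "x \<in> carrier R"
  shows "\<phi> x ! i \<in> carrier (Rs ! i)"
proof -
  interpret H: ring_hom_cring R "Rs ! i" "\<lambda>c. \<phi> c ! i" using proj_hom assms(1) .
  show ?thesis using assms(2) by (rule H.hom_closed)
qed

lemma ex_components:
  assumes ij: "i < length Rs" "j < length Rs" "i \<noteq> j"
    and xy: "x \<in> carrier (Rs ! i)" "y \<in> carrier (Rs ! j)"
  shows "\<exists>c\<in>carrier R. \<phi> c ! i = x \<and> \<phi> c ! j = y"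
proof -
  \<comment> \<open>The entries away from \<open>i\<close> and \<open>j\<close> are mere fillers;
    \<open>\<one>\<close> is one choice that lies in every carrier.\<close>
  let ?c = "\<lambda>l. if l = i then x else if l = j then y else \<one>\<^bsub>Rs ! l\<^esub>"
  have "?c l \<in> carrier (Rs ! l)" if "l < length Rs" for l
  proof -
    interpret S: local_ring "Rs ! l" using local_components that .
    show ?thesis using xy by simp
  qed
  then obtain c where "c \<in> carrier R" "\<And>l. l < length Rs \<Longrightarrow> \<phi> c ! l = ?c l"
    using proj_surj[of ?c] by blast
  then show ?thesis using ij by (intro bexI[of _ c]) auto
qed

text \<open>Each component is the image of the finite ring \<open>R\<close> under a projection,
  since any entry extends to a tuple.\<close>

lemma finite_component:
  assumes "i < length Rs"
  shows "finite (carrier (Rs ! i))"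
proof -
  have "carrier (Rs ! i) \<subseteq> (\<lambda>x. \<phi> x ! i) ` carrier R"
  proof
    fix d assume d: "d \<in> carrier (Rs ! i)"
    have "(if j = i then d else \<one>\<^bsub>Rs ! j\<^esub>) \<in> carrier (Rs ! j)" if "j < length Rs" for j
    proof -
      interpret S: local_ring "Rs ! j" using local_components that .
      show ?thesis using d by simp
    qed
    then obtain x where "x \<in> carrier R"
      "\<And>j. j < length Rs \<Longrightarrow> \<phi> x ! j = (if j = i then d else \<one>\<^bsub>Rs ! j\<^esub>)"
      using proj_surj[of "\<lambda>j. if j = i then d else \<one>\<^bsub>Rs ! j\<^esub>"] by blast
    then show "d \<in> (\<lambda>x. \<phi> x ! i) ` carrier R"
      using assms by (metis (mono_tags, lifting) imageI)
  qed
  then show ?thesis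
    using finite_carrier by (meson finite_imageI finite_subset)
qed

text \<open>Homomorphisms preserve units; conversely, the inverses of the entries assemble into one
  inverse \<open>y\<close>, because the projections are jointly bijective.\<close>

lemma Units_iff_proj:
  assumes x: "x \<in> carrier R"
  shows "x \<in> Units R \<longleftrightarrow> (\<forall>i<length Rs. \<phi> x ! i \<in> Units (Rs ! i))"
proof
  assume u: "x \<in> Units R"
  show "\<forall>i<length Rs. \<phi> x ! i \<in> Units (Rs ! i)"
  proof (intro allI impI)
    fix i assume i: "i < length Rs"
    interpret H: ring_hom_cring R "Rs ! i" "\<lambda>c. \<phi> c ! i" using proj_hom i .
    have "\<phi> (inv x) ! i \<otimes>\<^bsub>Rs ! i\<^esub> \<phi> x ! i = \<one>\<^bsub>Rs ! i\<^esub>"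
    proof -
      have "\<phi> (inv x \<otimes> x) ! i = \<one>\<^bsub>Rs ! i\<^esub>"
        using u H.hom_one by simp
      then show ?thesis using u H.hom_mult[of "inv x" x] x by simp
    qed
    moreover have "\<phi> (inv x) ! i \<in> carrier (Rs ! i)" "\<phi> x ! i \<in> carrier (Rs ! i)"
      using u x proj_closed[OF i] by auto
    ultimately show "\<phi> x ! i \<in> Units (Rs ! i)"
      using H.S.m_comm[of "\<phi> x ! i" "\<phi> (inv x) ! i"] unfolding Units_def by auto
  qed
next
  assume u: "\<forall>i<length Rs. \<phi> x ! i \<in> Units (Rs ! i)"
  have "inv\<^bsub>Rs ! i\<^esub> (\<phi> x ! i) \<in> carrier (Rs ! i)" if i: "i < length Rs" for i
  proof -
    interpret S: local_ring "Rs ! i" using local_components i .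
    show ?thesis using u i by simp
  qed
  then obtain y where y: "y \<in> carrier R"
    "\<And>i. i < length Rs \<Longrightarrow> \<phi> y ! i = inv\<^bsub>Rs ! i\<^esub> (\<phi> x ! i)"
    using proj_surj[of "\<lambda>i. inv\<^bsub>Rs ! i\<^esub> (\<phi> x ! i)"] by blast
  have "x \<otimes> y = \<one>"
  proof (rule proj_eqI)
    fix i assume i: "i < length Rs"
    interpret H: ring_hom_cring R "Rs ! i" "\<lambda>c. \<phi> c ! i" using proj_hom i .
    show "\<phi> (x \<otimes> y) ! i = \<phi> \<one> ! i"
      using H.hom_mult[OF x y(1)] H.hom_one y(2)[OF i] u i by simp
  qed (use x y in auto)
  then show "x \<in> Units R"
    using x y m_comm[of x y] unfolding Units_def by auto
qed

lemma exc_units_iff_proj: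
  assumes "x \<in> carrier R"
  shows "x \<in> exc_units R \<longleftrightarrow> (\<forall>i<length Rs. \<phi> x ! i \<in> exc_units (Rs ! i))"
proof -
  have "\<phi> (\<one> \<ominus> x) ! i = \<one>\<^bsub>Rs ! i\<^esub> \<ominus>\<^bsub>Rs ! i\<^esub> \<phi> x ! i" if i: "i < length Rs" for i
  proof -
    interpret H: ring_hom_cring R "Rs ! i" "\<lambda>c. \<phi> c ! i" using proj_hom i .
    show ?thesis
      using H.hom_add[of \<one> "\<ominus> x"] H.hom_one H.hom_a_inv[of x] assms
      by (simp add: a_minus_def)
  qed
  then show ?thesis
    using Units_iff_proj[OF assms] Units_iff_proj[of "\<one> \<ominus> x"] assms
    by (auto simp: exc_units_def)
qed

text \<open>Entries can be chosen independently, so decompositions in the components combine into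
  one in \<open>R\<close>. What couples the components is the common number \<open>k\<close> of
  terms.\<close>

lemma exc_sums_iff_proj:
  assumes "c \<in> carrier R"
  shows "c \<in> exc_sums R k \<longleftrightarrow> (\<forall>i<length Rs. \<phi> c ! i \<in> exc_sums (Rs ! i) k)"
  using assms
proof (induction k arbitrary: c)
  case 0
  have zero: "exc_sums (Rs ! i) 0 = {\<phi> \<zero> ! i}" if i: "i < length Rs" for i
  proof -
    interpret H: ring_hom_cring R "Rs ! i" "\<lambda>c. \<phi> c ! i" using proj_hom i .
    show ?thesis using H.hom_zero by (simp add: H.S.exc_sums_0)
  qed
  show ?case
    using 0 zero proj_eqI[of c \<zero>] by (auto simp: exc_sums_0)
next
  case (Suc k)
  have add: "\<phi> (x \<oplus> y) ! i = \<phi> x ! i \<oplus>\<^bsub>Rs ! i\<^esub> \<phi> y ! i"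
    if i: "i < length Rs" and "x \<in> carrier R" "y \<in> carrier R" for i x y
  proof -
    interpret H: ring_hom_cring R "Rs ! i" "\<lambda>c. \<phi> c ! i" using proj_hom i .
    show ?thesis using that by simp
  qed
  have step: "d \<in> exc_sums (Rs ! i) (Suc k) \<longleftrightarrow>
      (\<exists>s\<in>exc_sums (Rs ! i) k. \<exists>u\<in>exc_units (Rs ! i). d = s \<oplus>\<^bsub>Rs ! i\<^esub> u)"
    and closed: "exc_sums (Rs ! i) k \<subseteq> carrier (Rs ! i)" "exc_units (Rs ! i) \<subseteq> carrier (Rs ! i)"
    if i: "i < length Rs" for i d
  proof -
    interpret S: local_ring "Rs ! i" using local_components i .
    show "d \<in> exc_sums (Rs ! i) (Suc k) \<longleftrightarrow>
      (\<exists>s\<in>exc_sums (Rs ! i) k. \<exists>u\<in>exc_units (Rs ! i). d = s \<oplus>\<^bsub>Rs ! i\<^esub> u)"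
      by (auto simp: S.exc_sums_Suc set_add_def')
    show "exc_sums (Rs ! i) k \<subseteq> carrier (Rs ! i)" "exc_units (Rs ! i) \<subseteq> carrier (Rs ! i)"
      using S.exc_sums_closed S.exc_units_closed by auto
  qed
  show ?case
  proof
    assume "c \<in> exc_sums R (Suc k)"
    then obtain s u where su: "s \<in> exc_sums R k" "u \<in> exc_units R" "c = s \<oplus> u"
      by (auto simp: exc_sums_Suc set_add_def')
    then have closed_su: "s \<in> carrier R" "u \<in> carrier R"
      using exc_sums_closed exc_units_closed by auto
    show "\<forall>i<length Rs. \<phi> c ! i \<in> exc_sums (Rs ! i) (Suc k)"
    proof (intro allI impI)
      fix i assume i: "i < length Rs"
      have "\<phi> s ! i \<in> exc_sums (Rs ! i) k" "\<phi> u ! i \<in> exc_units (Rs ! i)"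
        using su i Suc.IH[of s] exc_units_iff_proj[of u] closed_su by auto
      then show "\<phi> c ! i \<in> exc_sums (Rs ! i) (Suc k)"
        using add[OF i closed_su] su(3) by (subst step[OF i]) auto
    qed
  next
    assume "\<forall>i<length Rs. \<phi> c ! i \<in> exc_sums (Rs ! i) (Suc k)"
    then have "\<forall>i. i < length Rs \<longrightarrow> (\<exists>s u. s \<in> exc_sums (Rs ! i) k \<and> u \<in> exc_units (Rs ! i) \<and>
        \<phi> c ! i = s \<oplus>\<^bsub>Rs ! i\<^esub> u)"
      by (simp add: step Bex_def)
    then obtain s u where su: "\<And>i. i < length Rs \<Longrightarrow> s i \<in> exc_sums (Rs ! i) k"
      "\<And>i. i < length Rs \<Longrightarrow> u i \<in> exc_units (Rs ! i)"
      "\<And>i. i < length Rs \<Longrightarrow> \<phi> c ! i = s i \<oplus>\<^bsub>Rs ! i\<^esub> u i"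
      by metis
    \<comment> \<open>The partial sums and the last summands are glued separately, to
      \<open>x\<close> and \<open>y\<close>.\<close>
    obtain x where x: "x \<in> carrier R" "\<And>i. i < length Rs \<Longrightarrow> \<phi> x ! i = s i"
      using proj_surj[of s] su(1) closed(1) by blast
    obtain y where y: "y \<in> carrier R" "\<And>i. i < length Rs \<Longrightarrow> \<phi> y ! i = u i"
      using proj_surj[of u] su(2) closed(2) by blast
    have "c = x \<oplus> y"
      using x y su(3) add Suc.prems by (intro proj_eqI) auto
    moreover have "x \<in> exc_sums R k" "y \<in> exc_units R"
      using x y su Suc.IH exc_units_iff_proj by auto
    ultimately show "c \<in> exc_sums R (Suc k)"
      by (auto simp: exc_sums_Suc set_add_def')
  qed
qed

section \<open>Components sorted by residue order\<close>

context
  fixes s t :: nat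
  assumes length_ge: "s + t \<le> length Rs"
    and order_3: "\<And>i. i < s \<Longrightarrow> residue_order (Rs ! i) = 3"
    and order_4: "\<And>i. s \<le> i \<Longrightarrow> i < s + t \<Longrightarrow> residue_order (Rs ! i) = 4"
    and order_gt_4: "\<And>i. s + t \<le> i \<Longrightarrow> i < length Rs \<Longrightarrow> residue_order (Rs ! i) > 4"
begin

text \<open>The last claim starts at \<open>k = 2\<close>: a single exceptional unit is never zero,
  so one term cannot fill a component.\<close>

lemma component_exc_sums:
  assumes i: "i < length Rs" and x: "x \<in> carrier (Rs ! i)"
  shows "i < s \<Longrightarrow> 1 \<le> k \<Longrightarrow> x \<in> exc_sums (Rs ! i) k \<longleftrightarrow> x \<in> class3 (Rs ! i) k"
    and "s \<le> i \<Longrightarrow> i < s + t \<Longrightarrow> 1 \<le> k \<Longrightarrow> x \<in> exc_sums (Rs ! i) k \<longleftrightarrow> x \<in> class4 (Rs ! i) k"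
    and "s + t \<le> i \<Longrightarrow> 2 \<le> k \<Longrightarrow> x \<in> exc_sums (Rs ! i) k"
proof -
  interpret S: local_ring "Rs ! i" using local_components i .
  note fin = finite_component[OF i]
  show "x \<in> exc_sums (Rs ! i) k \<longleftrightarrow> x \<in> class3 (Rs ! i) k" if "i < s" "1 \<le> k"
    using S.class3_iff_exc_sums[OF fin order_3[OF that(1)] that(2) x] by simp
  show "x \<in> exc_sums (Rs ! i) k \<longleftrightarrow> x \<in> class4 (Rs ! i) k" if "s \<le> i" "i < s + t" "1 \<le> k"
    using S.class4_iff_exc_sums[OF fin order_4[OF that(1,2)] that(3) x] by simp
  show "x \<in> exc_sums (Rs ! i) k" if "s + t \<le> i" "2 \<le> k"
    using S.exc_sums_residue_order_gt_4[OF fin order_gt_4[OF that(1) i] that(2)] x by simp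
qed

text \<open>Only components of residue order 3 or 4 are involved, so this already holds for
  \<open>k = 1\<close>. The obstruction below needs that case, since a representation may have a
  single term.\<close>

lemma exc_sums_imp_classes:
  assumes "c \<in> exc_sums R k" "1 \<le> k"
  shows "i < s \<Longrightarrow> \<phi> c ! i \<in> class3 (Rs ! i) k"
    and "s \<le> i \<Longrightarrow> i < s + t \<Longrightarrow> \<phi> c ! i \<in> class4 (Rs ! i) k"
proof -
  have c: "c \<in> carrier R" using assms(1) exc_sums_closed by blast
  then have proj: "\<phi> c ! i \<in> exc_sums (Rs ! i) k" if "i < length Rs" for i
    using assms(1) exc_sums_iff_proj that by blast
  show "\<phi> c ! i \<in> class3 (Rs ! i) k" if "i < s"
  proof -
    have i: "i < length Rs" using that length_ge by simp
    show ?thesis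
      using component_exc_sums(1)[OF i proj_closed[OF i c] that assms(2)] proj[OF i] by simp
  qed
  show "\<phi> c ! i \<in> class4 (Rs ! i) k" if "s \<le> i" "i < s + t"
  proof -
    have i: "i < length Rs" using that length_ge by simp
    show ?thesis
      using component_exc_sums(2)[OF i proj_closed[OF i c] that assms(2)] proj[OF i] by simp
  qed
qed

text \<open>Either of \<open>s\<close> and \<open>t\<close> may be 0, so the four cases of the
  theorem are instances.\<close>

lemma exc_sums_eq_classes:
  assumes k: "2 \<le> k"
  shows "exc_sums R k = {c \<in> carrier R. (\<forall>i<s. \<phi> c ! i \<in> class3 (Rs ! i) k)
    \<and> (\<forall>i. s \<le> i \<and> i < s + t \<longrightarrow> \<phi> c ! i \<in> class4 (Rs ! i) k)}"
proof (intro equalityI subsetI)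
  fix c assume "c \<in> exc_sums R k"
  then show "c \<in> {c \<in> carrier R. (\<forall>i<s. \<phi> c ! i \<in> class3 (Rs ! i) k)
    \<and> (\<forall>i. s \<le> i \<and> i < s + t \<longrightarrow> \<phi> c ! i \<in> class4 (Rs ! i) k)}"
    using exc_sums_imp_classes[of c k] exc_sums_closed[of k] k by auto
next
  fix c assume "c \<in> {c \<in> carrier R. (\<forall>i<s. \<phi> c ! i \<in> class3 (Rs ! i) k)
    \<and> (\<forall>i. s \<le> i \<and> i < s + t \<longrightarrow> \<phi> c ! i \<in> class4 (Rs ! i) k)}"
  then have c: "c \<in> carrier R"
    and c3: "\<And>i. i < s \<Longrightarrow> \<phi> c ! i \<in> class3 (Rs ! i) k"
    and c4: "\<And>i. s \<le> i \<Longrightarrow> i < s + t \<Longrightarrow> \<phi> c ! i \<in> class4 (Rs ! i) k"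
    by auto
  have "\<phi> c ! i \<in> exc_sums (Rs ! i) k" if i: "i < length Rs" for i
  proof -
    consider "i < s" | "s \<le> i" "i < s + t" | "s + t \<le> i" by linarith
    then show ?thesis
      using component_exc_sums[OF i proj_closed[OF i c], of k] c3 c4 k by cases auto
  qed
  then show "c \<in> exc_sums R k"
    using exc_sums_iff_proj[OF c] by blast
qed

text \<open>At most one component prescribes \<open>k\<close> modulo 3 and at most one prescribes
  its parity, and both demands can be met by one \<open>k\<close>.\<close>

lemma all_sums_if:
  assumes "s \<le> 1" "t \<le> 1"
  shows "all_sums_of_exc_units R"
  unfolding all_sums_of_exc_units_def
proof
  fix c assume c: "c \<in> carrier R"
  have "\<exists>r<3. \<forall>k. k mod 3 = r \<longrightarrow> (\<forall>i<s. \<phi> c ! i \<in> class3 (Rs ! i) k)"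
  proof (cases "s = 0")
    case False
    then have s: "s = 1" "0 < length Rs" using assms(1) length_ge by auto
    interpret S: local_ring "Rs ! 0" using local_components s(2) .
    show ?thesis
      using S.class3_exists[OF order_3 proj_closed[OF s(2) c]] s(1) by simp
  next
    case True
    then show ?thesis by (intro exI[of _ 0]) simp
  qed
  then obtain r where r: "r < 3" "\<And>k i. k mod 3 = r \<Longrightarrow> i < s \<Longrightarrow> \<phi> c ! i \<in> class3 (Rs ! i) k"
    by blast
  have "\<exists>b. \<forall>k. even k = b \<longrightarrow> (\<forall>i. s \<le> i \<and> i < s + t \<longrightarrow> \<phi> c ! i \<in> class4 (Rs ! i) k)"
  proof (cases "t = 0")
    case False
    then have t: "t = 1" "s < length Rs" using assms(2) length_ge by auto
    interpret S: local_ring "Rs ! s" using local_components t(2) .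
    have "s \<le> i \<and> i < s + t \<longleftrightarrow> i = s" for i using t(1) by auto
    then show ?thesis
      using S.class4_exists[OF proj_closed[OF t(2) c]] by simp
  next
    case True
    then have "\<not> (s \<le> i \<and> i < s + t)" for i by simp
    then show ?thesis by blast
  qed
  then obtain b where b: "\<And>k i. even k = b \<Longrightarrow> s \<le> i \<Longrightarrow> i < s + t \<Longrightarrow> \<phi> c ! i \<in> class4 (Rs ! i) k"
    by blast
  \<comment> \<open>An explicit Chinese remainder solution: \<open>4 * r\<close> is even and
    congruent to \<open>r\<close> modulo 3, adding 3 flips only the parity, and 6 ensures
    \<open>2 \<le> k\<close> without affecting either residue.\<close>
  define k where "k = 6 + 4 * r + (if b then 0 else 3)"
  have "k mod 3 = r"
  proof -
    have "k = r + 3 * (2 + r + (if b then 0 else 1))" by (simp add: k_def)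
    then have "k mod 3 = r mod 3" by (simp only: mod_mult_self2)
    then show ?thesis using r(1) by simp
  qed
  moreover have "even k = b" by (simp add: k_def)
  ultimately have "\<And>i. i < s \<Longrightarrow> \<phi> c ! i \<in> class3 (Rs ! i) k"
    "\<And>i. s \<le> i \<Longrightarrow> i < s + t \<Longrightarrow> \<phi> c ! i \<in> class4 (Rs ! i) k"
    using r(2) b by simp_all
  moreover have "2 \<le> k" by (simp add: k_def)
  ultimately have "c \<in> exc_sums R k"
    using c by (simp add: exc_sums_eq_classes)
  then show "\<exists>k\<ge>1. c \<in> exc_sums R k"
    using \<open>2 \<le> k\<close> by (intro exI[of _ k]) simp
qed

text \<open>With two components of residue order 3, the entries 0 and 1 force \<open>k\<close> to be
  both 0 and 2 modulo 3. With two of residue order 4, the entry 0 and an entry outside the cosets of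
  0 and 1 force \<open>k\<close> to be both even and odd.\<close>

lemma all_sums_only_if:
  assumes "all_sums_of_exc_units R"
  shows "s \<le> 1" "t \<le> 1"
proof -
  show "s \<le> 1"
  proof (rule ccontr)
    assume "\<not> s \<le> 1"
    then have s: "0 < s" "1 < s" "0 < length Rs" "1 < length Rs" using length_ge by auto
    interpret S: local_ring "Rs ! 0" using local_components s(3) .
    interpret T: local_ring "Rs ! 1" using local_components s(4) .
    obtain c where c: "c \<in> carrier R" "\<phi> c ! 0 = \<zero>\<^bsub>Rs ! 0\<^esub>" "\<phi> c ! 1 = \<one>\<^bsub>Rs ! 1\<^esub>"
      using ex_components[OF s(3,4) _ S.zero_closed T.one_closed] by auto
    then obtain k where k: "1 \<le> k" "c \<in> exc_sums R k"
      using assms unfolding all_sums_of_exc_units_def by blast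
    show False
      using exc_sums_imp_classes(1)[OF k(2,1) s(1)] exc_sums_imp_classes(1)[OF k(2,1) s(2)]
        S.zero_in_class3_iff[OF order_3[OF s(1)], of k]
        T.one_in_class3_iff[OF order_3[OF s(2)], of k] c by simp
  qed
  show "t \<le> 1"
  proof (rule ccontr)
    assume "\<not> t \<le> 1"
    then have t: "s < s + t" "Suc s < s + t" "s < length Rs" "Suc s < length Rs"
      using length_ge by auto
    interpret S: local_ring "Rs ! s" using local_components t(3) .
    interpret T: local_ring "Rs ! Suc s" using local_components t(4) .
    obtain z where z: "z \<in> carrier (Rs ! Suc s)" "\<And>k. z \<in> class4 (Rs ! Suc s) k \<longleftrightarrow> odd k"
      using T.ex_in_class4_iff_odd[OF order_4[OF _ t(2)]] by auto
    obtain c where c: "c \<in> carrier R" "\<phi> c ! s = \<zero>\<^bsub>Rs ! s\<^esub>" "\<phi> c ! Suc s = z"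
      using ex_components[OF t(3,4) _ S.zero_closed z(1)] by auto
    then obtain k where k: "1 \<le> k" "c \<in> exc_sums R k"
      using assms unfolding all_sums_of_exc_units_def by blast
    show False
      using exc_sums_imp_classes(2)[OF k(2,1) _ t(1)] exc_sums_imp_classes(2)[OF k(2,1) _ t(2)]
        S.zero_in_class4_iff[of k] z(2)[of k] c by simp
  qed
qed

text \<open>Where a case assumes \<open>s\<close> or \<open>t\<close> to be at least 1, the
  corresponding bound becomes an equality.\<close>

lemma all_sums_iff: "all_sums_of_exc_units R \<longleftrightarrow> s \<le> 1 \<and> t \<le> 1"
  using all_sums_if all_sums_only_if by blast

end

end

section \<open>The classes tabulated modulo 6\<close>

lemma mod_6_cases:
  fixes k :: nat
  obtains "k mod 6 = 0" "k mod 3 = 0" "even k" | "k mod 6 = 1" "k mod 3 = 1" "odd k"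
  | "k mod 6 = 2" "k mod 3 = 2" "even k" | "k mod 6 = 3" "k mod 3 = 0" "odd k"
  | "k mod 6 = 4" "k mod 3 = 1" "even k" | "k mod 6 = 5" "k mod 3 = 2" "odd k"
proof -
  define q r where "q = k div 6" and "r = k mod 6"
  have k: "k = 6 * q + r" by (simp add: q_def r_def)
  have "k = r + 3 * (2 * q)" using k by simp
  then have k3: "k mod 3 = r mod 3" by (metis mod_mult_self2)
  have k2: "even k = even r" using k by simp
  have "r < 6" by (simp add: r_def)
  then consider "r = 0" | "r = 1" | "r = 2" | "r = 3" | "r = 4" | "r = 5" by linarith
  then show thesis
    using that k2 k3 unfolding r_def[symmetric] by cases simp_all
qed

lemma class3_eq_nth_mod_6:
  "class3 R k =
    [max_ideal R, two_coset R, one_coset R, max_ideal R, two_coset R, one_coset R] ! (k mod 6)"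
  by (cases k rule: mod_6_cases) (simp_all add: class3_def)

lemma class4_eq_nth_mod_6:
  "class4 R k =
    [zero_one_cosets R, carrier R - zero_one_cosets R, zero_one_cosets R,
     carrier R - zero_one_cosets R, zero_one_cosets R, carrier R - zero_one_cosets R] ! (k mod 6)"
  by (cases k rule: mod_6_cases) (simp_all add: class4_def)

theorem theorem1p7:
  fixes R :: "('r, 'm) ring_scheme"
    and Rs :: "('a, 'n) ring_scheme list"
    and \<phi> :: "'r \<Rightarrow> 'a list"
  assumes "cring R" and "finite (carrier R)"
    and "\<And>i. i < length Rs \<Longrightarrow> local_ring (Rs ! i)"
    and "\<phi> \<in> ring_iso R (RDirProd_list Rs)"
    and "\<And>i. i < length Rs \<Longrightarrow> residue_order (Rs ! i) > 2"
  shows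
   "((\<forall>i<length Rs. residue_order (Rs ! i) > 4) \<longrightarrow>
        exc_units R <+>\<^bsub>R\<^esub> exc_units R = carrier R)
  \<and> (\<forall>s. 1 \<le> s \<and> s \<le> length Rs
        \<and> (\<forall>i<s. residue_order (Rs ! i) = 3)
        \<and> (\<forall>j. s \<le> j \<and> j < length Rs \<longrightarrow> residue_order (Rs ! j) > 4) \<longrightarrow>
        (\<forall>k\<ge>2. exc_sums R k = {c \<in> carrier R. \<forall>i<s. \<phi> c ! i \<in> class3 (Rs ! i) k})
      \<and> (all_sums_of_exc_units R \<longleftrightarrow> s = 1))
  \<and> (\<forall>t. 1 \<le> t \<and> t \<le> length Rs
        \<and> (\<forall>i<t. residue_order (Rs ! i) = 4)
        \<and> (\<forall>j. t \<le> j \<and> j < length Rs \<longrightarrow> residue_order (Rs ! j) > 4) \<longrightarrow>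
        (\<forall>k\<ge>2. exc_sums R k = {c \<in> carrier R. \<forall>i<t. \<phi> c ! i \<in> class4 (Rs ! i) k})
      \<and> (all_sums_of_exc_units R \<longleftrightarrow> t = 1))
  \<and> (\<forall>s t. 1 \<le> s \<and> 1 \<le> t \<and> s + t \<le> length Rs
        \<and> (\<forall>i<s. residue_order (Rs ! i) = 3)
        \<and> (\<forall>i. s \<le> i \<and> i < s + t \<longrightarrow> residue_order (Rs ! i) = 4)
        \<and> (\<forall>j. s + t \<le> j \<and> j < length Rs \<longrightarrow> residue_order (Rs ! j) > 4) \<longrightarrow>
        (\<forall>k\<ge>2. exc_sums R k =
            {c \<in> carrier R. (\<forall>i<s. \<phi> c ! i \<in> class3 (Rs ! i) k)
                \<and> (\<forall>i. s \<le> i \<and> i < s + t \<longrightarrow> \<phi> c ! i \<in> class4 (Rs ! i) k)})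
      \<and> (\<forall>k\<ge>2. exc_sums R k =
            {c \<in> carrier R.
                (\<forall>i<s. \<phi> c ! i \<in>
                   (let S = Rs ! i; M = max_ideal S
                    in [M, two_coset S, one_coset S, M, two_coset S, one_coset S] ! (k mod 6)))
              \<and> (\<forall>i. s \<le> i \<and> i < s + t \<longrightarrow> \<phi> c ! i \<in>
                   (let A = zero_one_cosets (Rs ! i); B = carrier (Rs ! i) - A
                    in [A, B, A, B, A, B] ! (k mod 6)))})
      \<and> (all_sums_of_exc_units R \<longleftrightarrow> s = 1 \<and> t = 1))"
proof -
  interpret finite_ring_decomp R Rs \<phi>
    using assms by (simp add: finite_ring_decomp_def finite_ring_decomp_axioms_def)
  show ?thesis
    (is "(?gt4 \<longrightarrow> ?sums2) \<and> (\<forall>s. ?h3 s \<longrightarrow> ?sums3 s \<and> ?all3 s) \<and>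
      (\<forall>t. ?h4 t \<longrightarrow> ?sums4 t \<and> ?all4 t) \<and>
      (\<forall>s t. ?h34 s t \<longrightarrow> ?sums34 s t \<and> ?sums6 s t \<and> ?all34 s t)")
  \<comment> \<open>The instances of \<open>conjI\<close> split only the outer conjunction and keep
    the claims within each case together under their common hypothesis.\<close>
  proof (intro conjI[of "?gt4 \<longrightarrow> ?sums2"] conjI[of "\<forall>s. ?h3 s \<longrightarrow> ?sums3 s \<and> ?all3 s"]
      conjI[of "\<forall>t. ?h4 t \<longrightarrow> ?sums4 t \<and> ?all4 t"] allI impI)
    assume h: ?gt4
    show ?sums2
      using exc_sums_eq_classes[of 0 0 2] h by (simp add: exc_sums_2)
  next
    fix s assume h: "?h3 s"
    have "?sums3 s"
    proof (intro allI impI)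
      fix k :: nat assume "2 \<le> k"
      then show "exc_sums R k = {c \<in> carrier R. \<forall>i<s. \<phi> c ! i \<in> class3 (Rs ! i) k}"
        using exc_sums_eq_classes[of s 0 k] h by auto
    qed
    moreover have "?all3 s"
      using all_sums_iff[of s 0] h by auto
    ultimately show "?sums3 s \<and> ?all3 s" by (rule conjI)
  next
    fix t assume h: "?h4 t"
    then have "?sums4 t"
      using exc_sums_eq_classes[of 0 t] by simp
    moreover have "?all4 t"
      using all_sums_iff[of 0 t] h by auto
    ultimately show "?sums4 t \<and> ?all4 t" by (rule conjI)
  next
    fix s t assume h: "?h34 s t"
    then have sums: "?sums34 s t"
      using exc_sums_eq_classes[of s t] by simp
    \<comment> \<open>Both forms coincide once the classes are replaced by their tables modulo
      6.\<close>
    then have "?sums6 s t"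
      by (simp only: Let_def class3_eq_nth_mod_6 class4_eq_nth_mod_6)
    moreover have "?all34 s t"
      using all_sums_iff[of s t] h by auto
    ultimately show "?sums34 s t \<and> ?sums6 s t \<and> ?all34 s t" using sums by (intro conjI)
  qed
qed

end
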